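(* Let $K$ be a nonempty closed convex cone in a finite-dimensional Euclidean space such that $K$ and its dual cone $K^*$ are both exposed, and let $L$ be an affine subspace. Assume that $K$ is pointed, i.e. $K\cap(-K)=\{0\}$, and that $L\cap K=\{0\}$. Let $G^1,\dots,G^p$ be faces of $K$ such that $$\mathrm{face}\Big(\bigcup_{j=1}^p(G^j\cap F),\,F\Big)=F\qquad\text{for all } F\unlhd K.$$ Then $$\mathrm{MSD}(L\cap K)\le\sum_{i=1}^p\mathrm{MSD}(L\cap G^i).$$
   Context: Notation. For a cone $C$, $C^*=\{y\mid\langle y,x\rangle\ge 0\ \forall x\in C\}$. For a set $S$, $S^\perp=\{y\mid \langle y,x\rangle=0\ \forall x\in S\}$ (also when $S$ is an affine subspace), and $w^\perp:=\{w\}^\perp$. A nonempty convex subcone $F\subseteq C$ is a face of $C$, written $F\unlhd C$, if $x,y\in C$ and $x+y\in F$ imply $x,y\in F$. A face $F$ of $C$ is exposed if $F=C\cap v^\perp$ for some $v\in C^*$; a cone is exposed if all its (nonempty) faces are. For $S\subseteq C$, $\mathrm{face}(S,C)$ denotes the smallest face of $C$ containing $S$. FR sequences and MSD. For a closed convex cone $C$ with $L\cap C\ne\emptyset$, facial reduction for $L\cap C$: set $F_0=C$; for $i=1,2,\dots$, as long as $L^\perp\cap(F_{i-1}^*\setminus F_{i-1}^\perp)\neq\emptyset$, choose any $w_i\in L^\perp\cap(F_{i-1}^*\setminus F_{i-1}^\perp)$ and set $F_i=F_{i-1}\cap w_i^\perp$. The procedure is run until it terminates, i.e. until $L^\perp\cap(F_d^*\setminus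 F_d^\perp)=\emptyset$, at which point $F_d$ is the smallest face of $C$ containing $L\cap C$. The resulting $(w_1,\dots,w_d)$ is called an FR sequence for $L\cap C$, of length $d$ (with $d=0$ if the procedure terminates immediately). $\mathrm{MSD}(L\cap C)$ is the maximum length among all FR sequences for $L\cap C$. In $\mathrm{MSD}(L\cap G^i)$ the cone is $C=G^i$. *)

theory Defs
  imports "HOL-Analysis.Analysis"
begin

definition dual_cone :: "'a::euclidean_space set \<Rightarrow> 'a set" where
  "dual_cone C = {y. \<forall>x\<in>C. 0 \<le> y \<bullet> x}"

text \<open>The library predicate \<^const>\<open>convex_cone\<close> includes nonemptiness, and closure under
  multiplication by \<open>0\<close>. The latter costs nothing: if \<open>0 \<in> C\<close> and \<open>x \<in> F\<close>, then
  \<open>x + 0 \<in> F\<close> already forces \<open>0 \<in> F\<close>.\<close>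

definition cone_face :: "'a::euclidean_space set \<Rightarrow> 'a set \<Rightarrow> bool"  (infix \<open>\<unlhd>\<close> 50) where
  "F \<unlhd> C \<longleftrightarrow> convex_cone F \<and> F \<subseteq> C \<and> (\<forall>x\<in>C. \<forall>y\<in>C. x + y \<in> F \<longrightarrow> x \<in> F \<and> y \<in> F)"

definition cone_exposed_face :: "'a::euclidean_space set \<Rightarrow> 'a set \<Rightarrow> bool" where
  "cone_exposed_face F C \<longleftrightarrow> F \<unlhd> C \<and> (\<exists>v\<in>dual_cone C. F = C \<inter> {v}\<^sup>\<bottom>)"

definition exposed_cone :: "'a::euclidean_space set \<Rightarrow> bool" where
  "exposed_cone C \<longleftrightarrow> (\<forall>F. F \<unlhd> C \<longrightarrow> cone_exposed_face F C)"

text \<open>The smallest face of \<open>C\<close> containing \<open>S\<close>, as the intersection of all such faces; by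
  \<open>min_face_is_face\<close> below it is itself a face.\<close>

definition min_face :: "'a::euclidean_space set \<Rightarrow> 'a set \<Rightarrow> 'a set" where
  "min_face S C = (\<lambda>F. F \<unlhd> C) hull S"

lemma min_face_is_face:
  assumes "convex_cone C" "S \<subseteq> C"
  shows "min_face S C \<unlhd> C" "S \<subseteq> min_face S C"
    and "\<And>F. F \<unlhd> C \<Longrightarrow> S \<subseteq> F \<Longrightarrow> min_face S C \<subseteq> F"
proof -
  have C: "C \<unlhd> C"
    using assms by (auto simp: cone_face_def)
  have "convex_cone (\<Inter>{F. F \<unlhd> C \<and> S \<subseteq> F})"
    by (rule convex_cone_Inter) (auto simp: cone_face_def)
  moreover have "\<Inter>{F. F \<unlhd> C \<and> S \<subseteq> F} \<subseteq> C"
    using C assms(2) by blast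
  moreover have "x \<in> \<Inter>{F. F \<unlhd> C \<and> S \<subseteq> F} \<and> y \<in> \<Inter>{F. F \<unlhd> C \<and> S \<subseteq> F}"
    if "x \<in> C" "y \<in> C" "x + y \<in> \<Inter>{F. F \<unlhd> C \<and> S \<subseteq> F}" for x y
    using that unfolding cone_face_def by blast
  ultimately show "min_face S C \<unlhd> C"
    unfolding min_face_def hull_def by (subst cone_face_def) blast
  show "S \<subseteq> min_face S C"
    unfolding min_face_def by (rule hull_subset)
  show "\<And>F. F \<unlhd> C \<Longrightarrow> S \<subseteq> F \<Longrightarrow> min_face S C \<subseteq> F"
    unfolding min_face_def by (rule hull_minimal)
qed

definition fr_directions :: "'a::euclidean_space set \<Rightarrow> 'a set \<Rightarrow> 'a set" where
  "fr_directions L F = L\<^sup>\<bottom> \<inter> (dual_cone F - F\<^sup>\<bottom>)"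

text \<open>The second argument is the current face \<open>F\<^bsub>i-1\<^esub>\<close> (initially the cone itself). The equation
  for \<open>[]\<close> makes FR sequences complete runs: the procedure may stop only when no direction is
  left.\<close>

fun fr_sequence :: "'a::euclidean_space set \<Rightarrow> 'a set \<Rightarrow> 'a list \<Rightarrow> bool" where
  "fr_sequence L F [] \<longleftrightarrow> fr_directions L F = {}"
| "fr_sequence L F (w # ws) \<longleftrightarrow> w \<in> fr_directions L F \<and> fr_sequence L (F \<inter> {w}\<^sup>\<bottom>) ws"

text \<open>The maximum is over a finite nonempty set, by \<open>fr_sequence_lengths\<close> below.\<close>

definition MSD :: "'a::euclidean_space set \<Rightarrow> 'a set \<Rightarrow> nat" where
  "MSD L C = Max {length ws | ws. fr_sequence L C ws}"

lemma fr_step_dim_less: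
  assumes "w \<in> fr_directions L F"
  shows "dim (F \<inter> {w}\<^sup>\<bottom>) < dim F"
proof -
  obtain x where x: "x \<in> F" "w \<bullet> x \<noteq> 0"
    using assms by (auto simp: fr_directions_def orthogonal_comp_def orthogonal_def inner_commute)
  have "span (F \<inter> {w}\<^sup>\<bottom>) \<subseteq> {w}\<^sup>\<bottom>"
    by (rule span_minimal) (auto simp: subspace_orthogonal_comp)
  with x have "x \<notin> span (F \<inter> {w}\<^sup>\<bottom>)"
    by (auto simp: orthogonal_comp_def orthogonal_def)
  moreover have "x \<in> span F"
    using x by (simp add: span_base)
  moreover have "span (F \<inter> {w}\<^sup>\<bottom>) \<subseteq> span F"
    by (intro span_mono) blast
  ultimately show ?thesis
    by (intro dim_psubset) blast
qed

lemma fr_sequence_length_le: "fr_sequence L F ws \<Longrightarrow> length ws \<le> dim F"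
proof (induction ws arbitrary: F)
  case (Cons w ws)
  then show ?case using fr_step_dim_less[of w L F] by fastforce
qed simp

lemma fr_sequence_exists: "\<exists>ws. fr_sequence L F ws"
proof (induction "dim F" arbitrary: F rule: less_induct)
  case less
  show ?case
  proof (cases "fr_directions L F = {}")
    case True
    then show ?thesis by (intro exI[of _ "[]"]) simp
  next
    case False
    then obtain w where "w \<in> fr_directions L F" by blast
    with less[OF fr_step_dim_less] show ?thesis
      by (metis fr_sequence.simps(2))
  qed
qed

lemma fr_sequence_lengths:
  "finite {length ws | ws. fr_sequence L C ws}" "{length ws | ws. fr_sequence L C ws} \<noteq> {}"
proof -
  have "{length ws | ws. fr_sequence L C ws} \<subseteq> {..dim C}"
    using fr_sequence_length_le by blast
  then show "finite {length ws | ws. fr_sequence L C ws}"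
    by (rule finite_subset) simp
  show "{length ws | ws. fr_sequence L C ws} \<noteq> {}"
    using fr_sequence_exists by blast
qed

end

theory Submission
  imports Defs
begin

text \<open>Every step of facial reduction on \<open>K\<close> is also a step on one of the \<open>G i\<close>. Let \<open>F\<close> be the
  current face of \<open>K\<close> and \<open>w\<close> the chosen direction, so that \<open>F \<inter> {w}\<^sup>\<bottom>\<close> is a proper face of \<open>F\<close>. As
  the pieces \<open>G i \<inter> F\<close> generate \<open>F\<close> as a face, they cannot all lie in \<open>F \<inter> {w}\<^sup>\<bottom>\<close>
  (\<open>some_piece_is_cut\<close>). The direction \<open>w\<close> is nonnegative on every piece, hence it is a legitimate
  reducing direction for each piece that it cuts, and it leaves the other pieces unchanged.
  A run on \<open>K\<close> therefore induces a run on each \<open>G i\<close>, possibly unfinished, by dropping the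
  directions that do nothing to \<open>G i\<close>; together these induced runs account for every step.

  Since \<open>MSD\<close> is a maximum over complete runs, the bookkeeping is done by a potential: the sum of
  \<open>MSD L (G i \<inter> F)\<close> over \<open>i\<close> bounds the number of steps still to come from \<open>F\<close>, because each step
  lowers at least one summand (\<open>Suc_MSD_step_le\<close>) and raises none (\<open>MSD_cut_le\<close>).\<close>

lemma fr_sequence_length_le_MSD:
  assumes "fr_sequence L C ws"
  shows "length ws \<le> MSD L C"
  unfolding MSD_def using assms by (intro Max_ge fr_sequence_lengths) blast

lemma MSD_attained: "\<exists>ws. fr_sequence L C ws \<and> length ws = MSD L C"
  using Max_in[OF fr_sequence_lengths[of L C]] by (auto simp: MSD_def)

lemma Suc_MSD_step_le:
  assumes "w \<in> fr_directions L C"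
  shows "Suc (MSD L (C \<inter> {w}\<^sup>\<bottom>)) \<le> MSD L C"
proof -
  obtain ws where "fr_sequence L (C \<inter> {w}\<^sup>\<bottom>) ws" "length ws = MSD L (C \<inter> {w}\<^sup>\<bottom>)"
    using MSD_attained by blast
  then show ?thesis
    using fr_sequence_length_le_MSD[of L C "w # ws"] assms by simp
qed

lemma subset_orthogonal_comp_singleton_iff: "C \<subseteq> {w}\<^sup>\<bottom> \<longleftrightarrow> w \<in> C\<^sup>\<bottom>"
  by (auto simp: orthogonal_comp_def orthogonal_commute)

lemma dual_cone_antimono: "S \<subseteq> T \<Longrightarrow> dual_cone T \<subseteq> dual_cone S"
  by (auto simp: dual_cone_def)

lemma fr_directions_subset:
  assumes "w \<in> fr_directions L C" "S \<subseteq> C" "\<not> S \<subseteq> {w}\<^sup>\<bottom>"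
  shows "w \<in> fr_directions L S"
  using assms dual_cone_antimono[of S C] subset_orthogonal_comp_singleton_iff[of S w]
  by (auto simp: fr_directions_def)

text \<open>A direction chosen for \<open>C\<close> either reduces the part \<open>S\<close> or contains it in its
  orthogonal complement, in which case \<open>S\<close> does not change.\<close>

lemma MSD_cut_le:
  assumes "w \<in> fr_directions L C" "S \<subseteq> C"
  shows "MSD L (S \<inter> {w}\<^sup>\<bottom>) \<le> MSD L S"
proof (cases "S \<subseteq> {w}\<^sup>\<bottom>")
  case True
  then show ?thesis by (simp add: Int_absorb2)
next
  case False
  then show ?thesis
    using Suc_MSD_step_le[OF fr_directions_subset[OF assms]] by simp
qed

lemma cone_face_trans:
  assumes "F \<unlhd> E" "E \<unlhd> C"
  shows "F \<unlhd> C"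
  using assms unfolding cone_face_def by blast

text \<open>A sum of two nonnegative inner products vanishes only if both do.\<close>

lemma dual_cone_cut_is_face:
  assumes "convex_cone C" "w \<in> dual_cone C"
  shows "C \<inter> {w}\<^sup>\<bottom> \<unlhd> C"
proof -
  have "convex_cone (\<Inter>{C, {w}\<^sup>\<bottom>})"
    using assms(1) subspace_imp_convex_cone[OF subspace_orthogonal_comp[of "{w}"]]
    by (intro convex_cone_Inter) auto
  then have "convex_cone (C \<inter> {w}\<^sup>\<bottom>)" by simp
  moreover have "x \<in> {w}\<^sup>\<bottom> \<and> y \<in> {w}\<^sup>\<bottom>" if "x \<in> C" "y \<in> C" "x + y \<in> {w}\<^sup>\<bottom>" for x y
  proof -
    have "0 \<le> w \<bullet> x" "0 \<le> w \<bullet> y" "w \<bullet> x + w \<bullet> y = 0"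
      using that assms(2)
      by (auto simp: dual_cone_def orthogonal_comp_def orthogonal_def inner_add_right)
    then show ?thesis
      by (auto simp: orthogonal_comp_def orthogonal_def)
  qed
  ultimately show ?thesis by (auto simp: cone_face_def)
qed

lemma fr_step_is_face:
  assumes "convex_cone F" "w \<in> fr_directions L F"
  shows "F \<inter> {w}\<^sup>\<bottom> \<unlhd> F"
  using assms by (intro dual_cone_cut_is_face) (auto simp: fr_directions_def)

text \<open>If every piece lay in \<open>{w}\<^sup>\<bottom>\<close>, then \<open>F \<inter> {w}\<^sup>\<bottom>\<close> would be a face containing all of them, hence
  equal to \<open>F\<close>; but a direction of facial reduction is not orthogonal to all of \<open>F\<close>.\<close>

lemma some_piece_is_cut:
  assumes "convex_cone F" "w \<in> fr_directions L F"
    and "min_face (\<Union>i\<in>I. G i \<inter> F) F = F"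
  shows "\<exists>i\<in>I. \<not> G i \<inter> F \<subseteq> {w}\<^sup>\<bottom>"
proof (rule ccontr)
  assume "\<not> ?thesis"
  then have "(\<Union>i\<in>I. G i \<inter> F) \<subseteq> F \<inter> {w}\<^sup>\<bottom>" by blast
  then have "F \<subseteq> {w}\<^sup>\<bottom>"
    using min_face_is_face(3)[OF assms(1) _ fr_step_is_face[OF assms(1,2)]] assms(3) by blast
  then show False
    using assms(2) by (simp add: subset_orthogonal_comp_singleton_iff fr_directions_def)
qed

text \<open>The potential argument. The induction runs over all faces \<open>F\<close> of \<open>K\<close>, since the rest of a run
  after its first step is a run starting from a smaller face.\<close>

lemma fr_sequence_length_le_sum_MSD:
  fixes G :: "'i \<Rightarrow> 'a::euclidean_space set"
  assumes "finite I"
    and gen: "\<And>F. F \<unlhd> K \<Longrightarrow> min_face (\<Union>i\<in>I. G i \<inter> F) F = F"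
    and "fr_sequence L F ws" "F \<unlhd> K"
  shows "length ws \<le> (\<Sum>i\<in>I. MSD L (G i \<inter> F))"
  using assms(3,4)
proof (induction ws arbitrary: F)
  case Nil
  then show ?case by simp
next
  case (Cons w ws)
  let ?F' = "F \<inter> {w}\<^sup>\<bottom>"
  have w: "w \<in> fr_directions L F" and ws: "fr_sequence L ?F' ws"
    using Cons.prems by simp_all
  have F: "convex_cone F"
    using \<open>F \<unlhd> K\<close> by (simp add: cone_face_def)
  obtain k where k: "k \<in> I" "\<not> G k \<inter> F \<subseteq> {w}\<^sup>\<bottom>"
    using some_piece_is_cut[OF F w gen[OF \<open>F \<unlhd> K\<close>]] by blast
  have "length ws \<le> (\<Sum>i\<in>I. MSD L (G i \<inter> ?F'))"
    using Cons.IH[OF ws cone_face_trans[OF fr_step_is_face[OF F w] \<open>F \<unlhd> K\<close>]] .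
  also have "\<dots> < (\<Sum>i\<in>I. MSD L (G i \<inter> F))"
  proof (rule sum_strict_mono_ex1[OF \<open>finite I\<close>])
    show "\<forall>i\<in>I. MSD L (G i \<inter> ?F') \<le> MSD L (G i \<inter> F)"
      using MSD_cut_le[OF w, of "G i \<inter> F" for i] by (simp add: Int_assoc)
    have "w \<in> fr_directions L (G k \<inter> F)"
      using fr_directions_subset[OF w] k(2) by blast
    then have "Suc (MSD L (G k \<inter> ?F')) \<le> MSD L (G k \<inter> F)"
      using Suc_MSD_step_le by (metis Int_assoc)
    with k(1) show "\<exists>i\<in>I. MSD L (G i \<inter> ?F') < MSD L (G i \<inter> F)"
      by (auto simp: Suc_le_eq)
  qed
  finally show ?case by simp
qed

theorem lemma5p2:
  fixes K L :: "'a::euclidean_space set" and G :: "nat \<Rightarrow> 'a set" and p :: nat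
  assumes "closed K" and "convex_cone K"
    and "exposed_cone K" and "exposed_cone (dual_cone K)"
    and "affine L"
    and "K \<inter> uminus ` K = {0}"
    and "L \<inter> K = {0}"
    and "\<And>i. i \<in> {1..p} \<Longrightarrow> G i \<unlhd> K"
    and "\<And>F. F \<unlhd> K \<Longrightarrow> min_face (\<Union>j\<in>{1..p}. G j \<inter> F) F = F"
  shows "MSD L K \<le> (\<Sum>i=1..p. MSD L (G i))"
proof -
  obtain ws where ws: "fr_sequence L K ws" "length ws = MSD L K"
    using MSD_attained by blast
  have "K \<unlhd> K"
    using assms(2) by (simp add: cone_face_def)
  with ws have "MSD L K \<le> (\<Sum>i\<in>{1..p}. MSD L (G i \<inter> K))"
    using fr_sequence_length_le_sum_MSD[where I = "{1..p}" and G = G and K = K, OF _ assms(9)]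
    by fastforce
  also have "\<dots> = (\<Sum>i=1..p. MSD L (G i))"
  proof (rule sum.cong)
    fix i assume "i \<in> {1..p}"
    then have "G i \<inter> K = G i"
      using assms(8) by (auto simp: cone_face_def)
    then show "MSD L (G i \<inter> K) = MSD L (G i)" by simp
  qed simp
  finally show ?thesis .
qed

end
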